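(* (i) There exist arbitrarily large finite sets $S\subset\mathbb R^2$, not contained in a conic and with no four points on a line, that determine at most $\frac{1}{24}|S|^4$ ordinary conics. (ii) There is an absolute constant $C$ and arbitrarily large finite sets $S\subset\mathbb R^2$, not contained in a conic and with at most $|S|/2$ points on any line, that determine at most $\frac{7}{384}|S|^4+C|S|^3$ ordinary conics.
   Context: A conic is the zero set in $\mathbb R^2$ of a real polynomial of degree $2$ in two variables; in particular a union of two distinct lines is a conic. A conic is an ordinary conic for a finite set $S\subset\mathbb R^2$ (and $S$ is said to determine it) if it contains exactly five points of $S$ and it is the only conic containing these five points. *)

theory Defs
  imports "HOL-Analysis.Analysis"
begin

text \<open>The general bivariate real polynomial of degree at most 2 is written out by its
  coefficients; its degree is exactly 2 iff one of the three quadratic coefficients is nonzero.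
  Conics are sets, not polynomials: a double line, a single point and the empty set are
  (degenerate) conics.\<close>

definition is_conic :: "(real \<times> real) set \<Rightarrow> bool" where
  "is_conic K \<longleftrightarrow>
    (\<exists>a b c d e f :: real. (a \<noteq> 0 \<or> b \<noteq> 0 \<or> c \<noteq> 0) \<and>
      K = {(x, y). a * x\<^sup>2 + b * x * y + c * y\<^sup>2 + d * x + e * y + f = 0})"

definition is_line :: "(real \<times> real) set \<Rightarrow> bool" where
  "is_line L \<longleftrightarrow> affine L \<and> aff_dim L = 1"

definition ordinary_conic :: "(real \<times> real) set \<Rightarrow> (real \<times> real) set \<Rightarrow> bool" where
  "ordinary_conic S K \<longleftrightarrow>
    is_conic K \<and> card (K \<inter> S) = 5 \<and> (\<forall>K'. is_conic K' \<and> K \<inter> S \<subseteq> K' \<longrightarrow> K' = K)"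

definition ordinary_conics :: "(real \<times> real) set \<Rightarrow> (real \<times> real) set set" where
  "ordinary_conics S = {K. ordinary_conic S K}"

text \<open>An ordinary conic is determined by its five points in \<^term>\<open>S\<close>, so for finite \<^term>\<open>S\<close> the
  \<^const>\<open>card\<close> of \<^term>\<open>ordinary_conics S\<close> is not the default value of an infinite set.\<close>

lemma finite_ordinary_conics:
  assumes "finite S"
  shows "finite (ordinary_conics S)"
proof (rule inj_on_finite)
  show "inj_on (\<lambda>K. K \<inter> S) (ordinary_conics S)"
  proof (rule inj_onI)
    fix K K' assume "K \<in> ordinary_conics S" "K' \<in> ordinary_conics S" "K \<inter> S = K' \<inter> S"
    then show "K = K'"
      unfolding ordinary_conics_def ordinary_conic_def by blast
  qed
  show "(\<lambda>K. K \<inter> S) ` ordinary_conics S \<subseteq> Pow S" by blast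
  show "finite (Pow S)" using assms by simp
qed

end

theory Submission imports Defs "HOL-Computational_Algebra.Polynomial" begin

text \<open>Six points of a plane cubic lie on a conic only if their sum vanishes in the group of the
  cubic. If \<^term>\<open>S\<close> is a finite subgroup, the sixth point of a conic through five points of
  \<^term>\<open>S\<close> is again in \<^term>\<open>S\<close>; an ordinary conic must therefore touch the cubic at one of its
  five points, which is determined by the other four when the order is odd.
  For (i) the acnodal cubic $x^3 - 3xy^2 = x^2 + y^2$ with the group of unit complex numbers is used;
  for (ii) the union of the hyperbola $x^2 - y^2 = 1$ and the line $x = 0$, which is projectively a
  circle with the line at infinity. With $n$ points on each component there are at most
  $n^4/24$ ordinary conics touching the line and $n^4/4$ touching the hyperbola.
  In both cases the group law is read off from Vieta's formula for the constant coefficient of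
  the polynomial obtained by restricting a conic to the cubic.\<close>

section \<open>Vieta's formula\<close>

lemma card_roots_le_degree:
  fixes P :: "'a::idom poly"
  assumes "P \<noteq> 0" "\<And>x. x \<in> A \<Longrightarrow> poly P x = 0"
  shows "card A \<le> degree P"
proof -
  have "card A \<le> card {x. poly P x = 0}"
    using assms by (intro card_mono poly_roots_finite) auto
  also have "\<dots> \<le> degree P"
    using assms(1) by (rule card_poly_roots_bound)
  finally show ?thesis .
qed

lemma prod_linear_factors_dvd:
  fixes P :: "'a::idom poly"
  assumes "finite T" "\<And>x. x \<in> T \<Longrightarrow> poly P x = 0"
  shows "(\<Prod>x\<in>T. [:- x, 1:]) dvd P"
  using assms
proof (induction T arbitrary: P rule: finite_induct)
  case (insert a T)
  then obtain Q where Q: "P = (\<Prod>x\<in>T. [:- x, 1:]) * Q"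
    by (metis dvdE insertCI)
  have "poly (\<Prod>x\<in>T. [:- x, 1:]) a \<noteq> 0"
    using insert.hyps by (auto simp: poly_prod)
  with insert.prems[of a] Q have "[:- a, 1:] dvd Q"
    by (simp add: poly_eq_0_iff_dvd)
  then have "[:- a, 1:] * (\<Prod>x\<in>T. [:- x, 1:]) dvd Q * (\<Prod>x\<in>T. [:- x, 1:])"
    by (rule mult_dvd_mono) simp
  moreover have "(\<Prod>x\<in>insert a T. [:- x, 1:]) = [:- a, 1:] * (\<Prod>x\<in>T. [:- x, 1:])"
    using insert.hyps by (rule prod.insert)
  ultimately show ?case
    using Q by (simp only: mult.commute)
qed auto

text \<open>The product of the linear factors over \<open>T\<close> is monic, and its value at 0 is
  its constant coefficient. Dividing it out thus keeps the leading coefficient and changes the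
  constant one only by the signed product of the roots.\<close>

lemma factor_out_roots:
  fixes P :: "'a::idom poly"
  assumes "finite T" "\<And>x. x \<in> T \<Longrightarrow> poly P x = 0" "P \<noteq> 0"
  obtains Q where "degree P = card T + degree Q" "lead_coeff P = lead_coeff Q"
    "coeff P 0 = (-1) ^ card T * \<Prod>T * coeff Q 0" "\<And>x. poly Q x = 0 \<Longrightarrow> poly P x = 0"
proof -
  let ?M = "\<Prod>x\<in>T. [:- x, 1:]"
  obtain Q where Q: "P = ?M * Q"
    using prod_linear_factors_dvd[OF assms(1,2)] by (auto elim: dvdE)
  have "lead_coeff ?M = 1"
    unfolding lead_coeff_prod by simp
  moreover have "degree ?M = card T" "?M \<noteq> 0"
    by (auto simp: degree_prod_eq_sum_degree assms(1))
  moreover have "coeff ?M 0 = (-1) ^ card T * \<Prod>T"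
    by (simp add: poly_0_coeff_0[symmetric] poly_prod prod_uminus)
  ultimately show thesis
    using Q assms(3) that[of Q] unfolding Q lead_coeff_mult
    by (simp add: coeff_mult_0 degree_mult_eq)
qed

lemma const_coeff_eq_prod_roots:
  fixes P :: "'a::idom poly"
  assumes "finite T" "\<And>x. x \<in> T \<Longrightarrow> poly P x = 0" "P \<noteq> 0" "degree P = card T"
  shows "coeff P 0 = (-1) ^ card T * lead_coeff P * \<Prod>T"
proof -
  obtain Q where "degree P = card T + degree Q" "lead_coeff P = lead_coeff Q"
    "coeff P 0 = (-1) ^ card T * \<Prod>T * coeff Q 0"
    by (rule factor_out_roots[OF assms(1-3)])
  with assms(4) show ?thesis by simp
qed

text \<open>The cofactor is linear, so over a field it has a root \<open>r\<close>. Nothing keeps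
  \<open>r\<close> outside \<open>T\<close>: \<open>r\<close> in \<open>T\<close> is the case of
  tangency, on which both counts rest.\<close>

lemma remaining_root:
  fixes P :: "'a::field poly"
  assumes "finite T" "\<And>x. x \<in> T \<Longrightarrow> poly P x = 0" "degree P = Suc (card T)"
  obtains r where "poly P r = 0" "coeff P 0 = (-1) ^ Suc (card T) * lead_coeff P * (r * \<Prod>T)"
proof -
  have "P \<noteq> 0"
    using assms(3) by auto
  then obtain Q where Q: "degree P = card T + degree Q" "lead_coeff P = lead_coeff Q"
    "coeff P 0 = (-1) ^ card T * \<Prod>T * coeff Q 0" "\<And>x. poly Q x = 0 \<Longrightarrow> poly P x = 0"
    using factor_out_roots[OF assms(1,2)] by blast
  then have d: "degree Q = 1"
    using assms(3) by simp
  then have nz: "coeff Q 1 \<noteq> 0"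
    using leading_coeff_neq_0[of Q] by fastforce
  have "poly Q (- coeff Q 0 / coeff Q 1) = 0"
    using d nz by (simp add: poly_altdef)
  with Q d nz show thesis
    by (intro that[of "- coeff Q 0 / coeff Q 1"]) simp_all
qed

section \<open>Restricting conics to the two cubics\<close>

text \<open>On the unit circle conjugation is inversion, so real and imaginary parts become Laurent
  polynomials in \<open>v\<close>.\<close>

lemma unit_circle_Re_Im:
  assumes "norm v = 1"
  shows "complex_of_real (Re v) = (v + 1 / v) / 2" "complex_of_real (Im v) = - \<i> * (v - 1 / v) / 2"
proof -
  have "v * cnj v = 1"
    using assms complex_norm_square[of v] by simp
  then have inv: "1 / v = cnj v"
    by (metis divide_eq_eq mult.commute mult_zero_left zero_neq_one)
  show "complex_of_real (Re v) = (v + 1 / v) / 2" "complex_of_real (Im v) = - \<i> * (v - 1 / v) / 2"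
    unfolding inv by (simp_all add: complex_eq_iff)
qed

text \<open>The five points on an ordinary conic determine it, so ordinary conics can be counted by
  their traces on \<open>S\<close>.\<close>

lemma ordinary_conic_eqI:
  assumes "K \<in> ordinary_conics S" "K' \<in> ordinary_conics S" "K \<inter> S = K' \<inter> S"
  shows "K = K'"
proof -
  have "is_conic K'"
    using assms(2) by (simp add: ordinary_conics_def ordinary_conic_def)
  moreover have "K \<inter> S \<subseteq> K'"
    unfolding assms(3) by (rule Int_lower1)
  ultimately show ?thesis
    using assms(1) unfolding ordinary_conics_def ordinary_conic_def by blast
qed

text \<open>In the plane dimension one is codimension one, so a line is a hyperplane, and its normal
  vector supplies the coefficients.\<close>

lemma is_line_equation:
  assumes "is_line L"
  obtains \<alpha> \<beta> \<gamma> where "\<alpha> \<noteq> 0 \<or> \<beta> \<noteq> 0" "\<And>x y. (x, y) \<in> L \<longleftrightarrow> \<alpha> * x + \<beta> * y = \<gamma>"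
proof -
  have dim: "aff_dim L = int (DIM(real \<times> real) - 1)" and hull: "affine hull L = L"
    using assms by (auto simp: is_line_def)
  from aff_dim_eq_hyperplane[THEN iffD1, OF dim, unfolded hull]
  obtain w \<gamma> where w: "w \<noteq> 0" "L = {x. w \<bullet> x = \<gamma>}"
    by (elim exE conjE)
  obtain \<alpha> \<beta> where "w = (\<alpha>, \<beta>)"
    by (cases w)
  with w have "\<alpha> \<noteq> 0 \<or> \<beta> \<noteq> 0" "(x, y) \<in> L \<longleftrightarrow> \<alpha> * x + \<beta> * y = \<gamma>" for x y
    by (auto simp: zero_prod_def)
  then show thesis
    by (rule that)
qed

text \<open>The conic is evaluated at x = Re v / Re(v^3), y = Im v / Re(v^3) and multiplied by 4 v^6
  Re(v^3)^2; the result is a polynomial in v^2. Its constant and leading coefficients are both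
  \<open>f\<close>, so for nonzero \<open>f\<close> its six roots multiply to 1. The case
  \<open>f = 0\<close> is that of conics through the origin, the isolated point of the
  cubic.\<close>

definition cubic_conic_poly :: "real \<Rightarrow> real \<Rightarrow> real \<Rightarrow> real \<Rightarrow> real \<Rightarrow> real \<Rightarrow> complex poly" where
  "cubic_conic_poly a b c d e f =
    [:of_real f, Complex d e, Complex (d + a - c) (b - e), of_real (2 * (f + a + c)),
      Complex (d + a - c) (e - b), Complex d (- e), of_real f:]"

lemma poly_cubic_conic_poly:
  assumes v: "norm v = 1"
  shows "poly (cubic_conic_poly a b c d e f) (v\<^sup>2) =
    4 * v ^ 6 * of_real (a * (Re v)\<^sup>2 + b * Re v * Im v + c * (Im v)\<^sup>2 + d * Re v * Re (v ^ 3) + e * Im v * Re (v ^ 3) + f * (Re (v ^ 3))\<^sup>2)"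
proof -
  have v0: "v \<noteq> 0" and v3: "norm (v ^ 3) = 1"
    using v by (auto simp: norm_power)
  have i: "\<i> * (\<i> * x) = - x" for x by (simp flip: mult.assoc)
  show ?thesis
    unfolding cubic_conic_poly_def of_real_add of_real_mult of_real_power
      unit_circle_Re_Im[OF v] unit_circle_Re_Im[OF v3]
    using v0 by (simp add: Complex_eq field_simps power2_eq_square eval_nat_numeral i)
qed


text \<open>The lowest coefficients force f = d = e = 0; the next ones then give a = c, b = 0 and a
  = -c.\<close>

lemma cubic_conic_poly_eq_0D:
  assumes "cubic_conic_poly a b c d e f = 0"
  shows "a = 0 \<and> b = 0 \<and> c = 0"
  using assms by (auto simp: cubic_conic_poly_def complex_eq_iff)

text \<open>The conic at x = 1 / Re z, y = Im z / Re z, multiplied by 4 z^2 Re(z)^2. Here the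
  variable is \<open>z\<close> itself, not its square.\<close>

definition hyperbola_conic_poly :: "real \<Rightarrow> real \<Rightarrow> real \<Rightarrow> real \<Rightarrow> real \<Rightarrow> real \<Rightarrow> complex poly" where
  "hyperbola_conic_poly a b c d e f =
    [:Complex (f - c) e, Complex (2 * d) (2 * b), of_real (4 * a + 2 * c + 2 * f),
      Complex (2 * d) (- 2 * b), Complex (f - c) (- e):]"

lemma poly_hyperbola_conic_poly:
  assumes z: "norm z = 1"
  shows "poly (hyperbola_conic_poly a b c d e f) z =
    4 * z\<^sup>2 * of_real (a + b * Im z + c * (Im z)\<^sup>2 + d * Re z + e * Im z * Re z + f * (Re z)\<^sup>2)"
proof -
  have z0: "z \<noteq> 0"
    using z by auto
  have i: "\<i> * (\<i> * x) = - x" for x by (simp flip: mult.assoc)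
  show ?thesis
    unfolding hyperbola_conic_poly_def of_real_add of_real_mult of_real_power unit_circle_Re_Im[OF z]
    using z0 by (simp add: Complex_eq field_simps power2_eq_square eval_nat_numeral i)
qed

text \<open>The outer coefficients agree with those of \<open>hyperbola_conic_poly\<close>, so the
  four roots on the hyperbola and the two on the line have the same product whenever these
  coefficients are nonzero. They are the values of the conic at (0, i) and (0, -i), the complex
  points where hyperbola and line meet.\<close>

definition line_conic_poly :: "real \<Rightarrow> real \<Rightarrow> real \<Rightarrow> complex poly" where
  "line_conic_poly c e f = [:Complex (f - c) e, of_real (2 * c + 2 * f), Complex (f - c) (- e):]"

lemma poly_line_conic_poly:
  assumes v: "norm v = 1"
  shows "poly (line_conic_poly c e f) (v\<^sup>2) =
    4 * v\<^sup>2 * of_real (c * (Im v)\<^sup>2 + e * Im v * Re v + f * (Re v)\<^sup>2)"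
proof -
  have v0: "v \<noteq> 0"
    using v by auto
  have i: "\<i> * (\<i> * x) = - x" for x by (simp flip: mult.assoc)
  show ?thesis
    unfolding line_conic_poly_def of_real_add of_real_mult of_real_power unit_circle_Re_Im[OF v]
    using v0 by (simp add: Complex_eq field_simps power2_eq_square eval_nat_numeral i)
qed

lemma hyperbola_line_conic_poly_eq_0D:
  assumes "hyperbola_conic_poly a b c d e f = 0" "line_conic_poly c e f = 0"
  shows "a = 0 \<and> b = 0 \<and> c = 0"
  using assms by (auto simp: hyperbola_conic_poly_def line_conic_poly_def complex_eq_iff)

section \<open>The group of roots of unity of odd order\<close>

text \<open>Odd order makes squaring bijective on \<open>U\<close> and keeps the imaginary axis free
  of points of \<open>U\<close>. Seven elements are more than the roots of any nonzero restricted
  polynomial, whose degree is at most 6.\<close>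

locale odd_roots_of_unity =
  fixes n :: nat and U :: "complex set"
  assumes odd: "odd n" and large: "n \<ge> 7"
  defines "U \<equiv> {z. z ^ n = 1}"
begin

lemma finite_U: "finite U" and card_U: "card U = n"
  using large by (simp_all add: U_def finite_roots_unity card_roots_unity_eq)

lemma norm_U: "z \<in> U \<Longrightarrow> norm z = 1"
  using large power_eq_1_iff[of z n] by (simp add: U_def)

lemma nonzero_U: "z \<in> U \<Longrightarrow> z \<noteq> 0"
  using norm_U by force

lemma mult_U: "z \<in> U \<Longrightarrow> w \<in> U \<Longrightarrow> z * w \<in> U"
  by (simp add: U_def power_mult_distrib)

lemma divide_U: "z \<in> U \<Longrightarrow> w \<in> U \<Longrightarrow> z / w \<in> U"
  by (simp add: U_def power_divide)

lemma one_U: "1 \<in> U"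
  by (simp add: U_def)

lemma power_U: "z \<in> U \<Longrightarrow> z ^ k \<in> U"
  by (simp add: U_def flip: power_mult) (simp add: mult.commute[of k] power_mult)

lemma prod_U: "A \<subseteq> U \<Longrightarrow> \<Prod>A \<in> U"
  by (induction A rule: infinite_finite_induct) (auto simp: one_U mult_U)

text \<open>The square root inside \<^term>\<open>U\<close>, which exists because \<^term>\<open>n\<close> is odd.\<close>

definition half :: "complex \<Rightarrow> complex" where
  "half z = z ^ (Suc n div 2)"

lemma half_U: "z \<in> U \<Longrightarrow> half z \<in> U"
  unfolding half_def by (rule power_U)

text \<open>The exponent (n + 1) / 2 in \<open>half\<close> is the inverse of 2 modulo the odd
  number \<open>n\<close>.\<close>

lemma half_square: "z \<in> U \<Longrightarrow> half (z\<^sup>2) = z"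
  using odd by (auto simp: U_def half_def power2_eq_square mult.assoc elim!: oddE simp flip: power_mult)
    (simp add: power2_eq_square power_mult)

lemma square_half: "z \<in> U \<Longrightarrow> (half z)\<^sup>2 = z"
  using half_square[of z] by (simp add: half_def flip: power_mult) (simp add: mult.commute)

lemma inj_on_square: "inj_on (\<lambda>z. z\<^sup>2) U"
  using half_square by (rule inj_on_inverseI)

text \<open>A purely imaginary \<open>z\<close> would have z^2 = -1, whose odd powers are -1.
  Consequently the denominators in the parametrizations below never vanish on
  \<open>U\<close>.\<close>

lemma Re_nonzero_U:
  assumes "z \<in> U"
  shows "Re z \<noteq> 0"
proof
  assume "Re z = 0"
  moreover have "(Re z)\<^sup>2 + (Im z)\<^sup>2 = 1"
    using norm_U[OF assms] by (simp add: cmod_power2[symmetric])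
  ultimately have "z\<^sup>2 = -1"
    by (simp add: complex_eq_iff power2_eq_square)
  moreover have "(z\<^sup>2) ^ n = 1"
    using power_U[OF assms, of 2] by (simp add: U_def)
  ultimately show False
    using odd by simp
qed

text \<open>Since \<^term>\<open>n\<close> is odd, \<^term>\<open>U\<close> contains no pair of opposite points, hence embeds into the
  projective line of directions.\<close>

lemma eq_if_parallel:
  assumes "z \<in> U" "w \<in> U" "r \<noteq> 0" "s \<noteq> 0" "Re z / r = Re w / s" "Im z / r = Im w / s"
  shows "z = w"
proof -
  have eq: "z = of_real (r / s) * w"
    using assms(3-6) by (simp add: complex_eq_iff field_simps)
  then have "\<bar>r / s\<bar> = 1"
    using norm_U[OF assms(1)] norm_U[OF assms(2)] by (metis mult.right_neutral norm_mult norm_of_real)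
  then have "(r / s)\<^sup>2 = 1"
    by (metis one_power2 power2_abs)
  then have "z\<^sup>2 = w\<^sup>2"
    unfolding eq power_mult_distrib of_real_power[symmetric] by simp
  with assms(1,2) show ?thesis
    using inj_on_square by (auto dest: inj_onD)
qed

subsection \<open>A subgroup of the acnodal cubic\<close>

text \<open>For v = exp(it) this is exp(it) / cos(3t), and r cos(3t) = 1 is the polar equation of
  the acnodal cubic without its isolated point. Since \<open>v\<close> and \<open>-v\<close> give
  the same point, the natural group parameter is v^2.\<close>

definition cubic_point :: "complex \<Rightarrow> real \<times> real" where
  "cubic_point v = (Re v / Re (v ^ 3), Im v / Re (v ^ 3))"

lemma inj_on_cubic_point: "inj_on cubic_point U"
proof (rule inj_onI)
  fix z w assume "z \<in> U" "w \<in> U" "cubic_point z = cubic_point w"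
  then show "z = w"
    using eq_if_parallel[of z w "Re (z ^ 3)" "Re (w ^ 3)"] Re_nonzero_U power_U
    by (auto simp: cubic_point_def)
qed

lemma cubic_point_in_conic_iff:
  assumes v: "v \<in> U" and K: "K = {(x, y). a * x\<^sup>2 + b * x * y + c * y\<^sup>2 + d * x + e * y + f = 0}"
  shows "cubic_point v \<in> K \<longleftrightarrow> poly (cubic_conic_poly a b c d e f) (v\<^sup>2) = 0"
proof -
  have nz: "Re (v ^ 3) \<noteq> 0"
    using Re_nonzero_U power_U v by blast
  have "cubic_point v \<in> K \<longleftrightarrow> a * (Re v)\<^sup>2 + b * Re v * Im v + c * (Im v)\<^sup>2 + d * Re v * Re (v ^ 3)
      + e * Im v * Re (v ^ 3) + f * (Re (v ^ 3))\<^sup>2 = 0"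
    using nz unfolding K cubic_point_def
    by (simp add: field_simps power2_eq_square)
  then show ?thesis
    unfolding poly_cubic_conic_poly[OF norm_U[OF v]] using nonzero_U[OF v]
    by (simp only: mult_eq_0_iff of_real_eq_0_iff) simp
qed

lemma cubic_not_subset_conic:
  assumes "is_conic K"
  shows "\<not> cubic_point ` U \<subseteq> K"
proof
  assume sub: "cubic_point ` U \<subseteq> K"
  obtain a b c d e f where nz: "a \<noteq> 0 \<or> b \<noteq> 0 \<or> c \<noteq> 0"
    and K: "K = {(x, y). a * x\<^sup>2 + b * x * y + c * y\<^sup>2 + d * x + e * y + f = 0}"
    using assms unfolding is_conic_def by blast
  let ?P = "cubic_conic_poly a b c d e f"
  have "card ((\<lambda>v. v\<^sup>2) ` U) \<le> degree ?P"
    using nz cubic_conic_poly_eq_0D[of a b c d e f] sub cubic_point_in_conic_iff[OF _ K]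
    by (intro card_roots_le_degree) auto
  moreover have "degree ?P \<le> 6"
    by (simp add: cubic_conic_poly_def)
  ultimately show False
    using large by (simp add: card_image inj_on_square card_U)
qed

text \<open>Multiplying the line equation at \<open>cubic_point v\<close> by 2 v^3 Re(v^3) gives a
  polynomial of degree at most 3 in v^2.\<close>

lemma card_cubic_line_le:
  assumes "is_line L"
  shows "card (cubic_point ` U \<inter> L) \<le> 3"
proof -
  obtain \<alpha> \<beta> \<gamma> where nz: "\<alpha> \<noteq> 0 \<or> \<beta> \<noteq> 0" and L: "\<And>x y. (x, y) \<in> L \<longleftrightarrow> \<alpha> * x + \<beta> * y = \<gamma>"
    using is_line_equation[OF assms] by metis
  let ?P = "[:- of_real \<gamma>, Complex \<alpha> \<beta>, Complex \<alpha> (- \<beta>), - of_real \<gamma>:]"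
  let ?T = "{v \<in> U. cubic_point v \<in> L}"
  have root: "poly ?P (v\<^sup>2) = 0" if "v \<in> ?T" for v
  proof -
    have "v \<in> U" and *: "\<alpha> * Re v + \<beta> * Im v - \<gamma> * Re (v ^ 3) = 0"
      using that Re_nonzero_U power_U by (auto simp: L cubic_point_def field_simps)
    then have v: "norm v = 1" "norm (v ^ 3) = 1" "v \<noteq> 0"
      using norm_U power_U nonzero_U by auto
    have i: "\<i> * (\<i> * x) = - x" for x by (simp flip: mult.assoc)
    have "poly ?P (v\<^sup>2) = 2 * v ^ 3 * of_real (\<alpha> * Re v + \<beta> * Im v - \<gamma> * Re (v ^ 3))"
      unfolding of_real_add of_real_mult of_real_diff unit_circle_Re_Im[OF v(1)] unit_circle_Re_Im[OF v(2)]
      using v(3) by (simp add: Complex_eq field_simps eval_nat_numeral i)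
    with * show ?thesis by simp
  qed
  have "card (cubic_point ` U \<inter> L) = card (cubic_point ` ?T)"
    by (rule arg_cong[where f = card]) auto
  also have "\<dots> = card ((\<lambda>v. v\<^sup>2) ` ?T)"
    by (simp add: card_image inj_on_subset[OF inj_on_cubic_point] inj_on_subset[OF inj_on_square])
  also have "\<dots> \<le> degree ?P"
    using nz root by (intro card_roots_le_degree) (auto simp: complex_eq_iff)
  also have "\<dots> \<le> 3"
    by simp
  finally show ?thesis .
qed

text \<open>Five of the six roots are squares of elements of \<open>U\<close>, and all six multiply
  to 1, so the last root lies in the group \<open>U\<close> too. Its square root in \<open>U\<close>
  yields a point on \<open>K\<close>, which must be one of the five: there the conic meets the cubic
  with multiplicity two.\<close>

lemma cubic_conic_sixth_point:
  assumes "is_conic K" "card {v \<in> U. cubic_point v \<in> K} = 5"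
  shows "\<exists>u\<in>{v \<in> U. cubic_point v \<in> K}. u * \<Prod>{v \<in> U. cubic_point v \<in> K} = 1"
proof -
  define T where "T = {v \<in> U. cubic_point v \<in> K}"
  have T: "card T = 5" "T \<subseteq> U"
    unfolding T_def by (rule assms(2)) blast
  have "finite T"
    using T(2) finite_U by (rule finite_subset)
  obtain a b c d e f
    where K: "K = {(x, y). a * x\<^sup>2 + b * x * y + c * y\<^sup>2 + d * x + e * y + f = 0}"
    using assms(1) unfolding is_conic_def by blast
  let ?P = "cubic_conic_poly a b c d e f"
  let ?W = "(\<lambda>v. v\<^sup>2) ` T"
  have T_iff: "v \<in> T \<longleftrightarrow> poly ?P (v\<^sup>2) = 0" if "v \<in> U" for v
    using cubic_point_in_conic_iff[OF that K] that by (auto simp: T_def)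
  have W: "finite ?W" "card ?W = 5"
    using T \<open>finite T\<close> by (simp_all add: card_image inj_on_subset[OF inj_on_square])
  have W_root: "poly ?P w = 0" and W_nonzero: "w \<noteq> 0" if "w \<in> ?W" for w
    using that T(2) T_iff nonzero_U by auto
  have P0: "?P \<noteq> 0"
  proof
    assume "?P = 0"
    then have "T = U" using T_iff T by auto
    then show False using T card_U large by simp
  qed
  \<comment> \<open>For \<open>f = 0\<close> the leading and the constant coefficient vanish
    together, which leaves at most four nonzero roots for five distinct values.\<close>
  have "f \<noteq> 0"
  proof
    assume f: "f = 0"
    let ?Q = "[:Complex d e, Complex (d + a - c) (b - e), of_real (2 * (a + c)),
      Complex (d + a - c) (e - b), Complex d (- e):]"
    have PQ: "?P = pCons 0 ?Q"
      by (simp add: cubic_conic_poly_def f)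
    have "card ?W \<le> degree ?Q"
    proof (rule card_roots_le_degree)
      show "?Q \<noteq> 0" using P0 PQ by auto
      show "poly ?Q w = 0" if "w \<in> ?W" for w
        using W_root[OF that] W_nonzero[OF that] unfolding PQ by simp
    qed
    also have "\<dots> \<le> 4" by simp
    finally show False using W by simp
  qed
  then have P: "degree ?P = 6" "lead_coeff ?P = of_real f" "coeff ?P 0 = of_real f"
    by (simp_all add: cubic_conic_poly_def eval_nat_numeral)
  obtain r where r: "poly ?P r = 0" "coeff ?P 0 = (-1) ^ Suc (card ?W) * lead_coeff ?P * (r * \<Prod>?W)"
    by (rule remaining_root[OF W(1) W_root]) (use P W in simp_all)
  have prod_W: "\<Prod>?W = (\<Prod>T)\<^sup>2"
    using T by (simp add: prod.reindex inj_on_subset[OF inj_on_square] prod_power_distrib)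
  then have eq: "r * (\<Prod>T)\<^sup>2 = 1"
    using r(2) \<open>f \<noteq> 0\<close> unfolding P(2,3) W(2) by simp
  have TU: "\<Prod>T \<in> U"
    using T by (intro prod_U)
  have "r = 1 / (\<Prod>T)\<^sup>2"
    using eq nonzero_U[OF TU] by (simp add: field_simps)
  then have rU: "r \<in> U"
    using divide_U one_U power_U TU by simp
  then have "half r \<in> T"
    using T_iff[OF half_U[OF rU]] r(1) by (simp add: square_half)
  \<comment> \<open>Both bases lie in \<open>U\<close>, where squaring is injective, so the square
    root has no sign ambiguity.\<close>
  moreover have "(half r * \<Prod>T)\<^sup>2 = 1\<^sup>2"
    using eq by (simp add: power_mult_distrib square_half rU)
  then have "half r * \<Prod>T = 1"
    using inj_onD[OF inj_on_square] mult_U[OF half_U[OF rU] TU] one_U by blast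
  ultimately show ?thesis
    unfolding T_def by blast
qed

text \<open>The point of contact \<open>u\<close> enters the product twice, so u^2 is the inverse of
  the product of the other four parameters and \<open>half\<close> recovers \<open>u\<close>. Every
  trace therefore arises from a 4-subset of \<open>U\<close>.\<close>

lemma card_ordinary_conics_cubic: "card (ordinary_conics (cubic_point ` U)) \<le> n choose 4"
proof -
  let ?S = "cubic_point ` U"
  define trace where "trace K = {v \<in> U. cubic_point v \<in> K}" for K
  have trace: "K \<inter> ?S = cubic_point ` trace K" for K
    by (auto simp: trace_def)
  have inj: "inj_on trace (ordinary_conics ?S)"
    by (rule inj_onI, erule (1) ordinary_conic_eqI) (simp add: trace)
  let ?R = "{R. R \<subseteq> U \<and> card R = 4}"
  have "trace ` ordinary_conics ?S \<subseteq> (\<lambda>R. insert (half (1 / \<Prod>R)) R) ` ?R"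
  proof clarify
    fix K assume "K \<in> ordinary_conics ?S"
    then have K: "is_conic K" "card (trace K) = 5"
      using card_image[OF inj_on_subset[OF inj_on_cubic_point], of "trace K"]
      by (auto simp: ordinary_conics_def ordinary_conic_def trace) (auto simp: trace_def)
    then obtain u where u: "u \<in> trace K" "u * \<Prod>(trace K) = 1"
      using cubic_conic_sixth_point unfolding trace_def by blast
    let ?T = "trace K - {u}"
    have TU: "trace K \<subseteq> U" by (auto simp: trace_def)
    then have fin: "finite (trace K)" using finite_U by (rule finite_subset)
    have "u * (u * \<Prod>?T) = 1"
      using u prod.remove[OF fin u(1), of "\<lambda>x. x"] by simp
    moreover have "\<Prod>?T \<noteq> 0"
      using TU by (intro nonzero_U prod_U) auto
    ultimately have "1 / \<Prod>?T = u\<^sup>2"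
      by (auto simp: field_simps power2_eq_square)
    then have "trace K = insert (half (1 / \<Prod>?T)) ?T"
      using u half_square TU by auto
    moreover have "?T \<in> ?R" using TU K u fin by auto
    ultimately show "trace K \<in> (\<lambda>R. insert (half (1 / \<Prod>R)) R) ` ?R"
      by blast
  qed
  then have "card (trace ` ordinary_conics ?S) \<le> card ?R"
    using finite_U by (intro surj_card_le) auto
  then show ?thesis
    using inj by (simp add: card_image n_subsets finite_U card_U)
qed

subsection \<open>A subgroup of the hyperbola with a line\<close>

text \<open>For z = exp(it) this is (sec t, tan t), on the hyperbola x^2 - y^2 = 1.\<close>

definition hyperbola_point :: "complex \<Rightarrow> real \<times> real" where
  "hyperbola_point z = (1 / Re z, Im z / Re z)"

text \<open>The height tan t is the same for \<open>v\<close> and \<open>-v\<close>, so the group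
  parameter on the line is v^2, while on the hyperbola it is \<open>z\<close>.\<close>

definition line_point :: "complex \<Rightarrow> real \<times> real" where
  "line_point v = (0, Im v / Re v)"

lemma inj_on_hyperbola_point: "inj_on hyperbola_point U"
  by (rule inj_onI) (use Re_nonzero_U in \<open>force simp: hyperbola_point_def complex_eq_iff\<close>)

lemma inj_on_line_point: "inj_on line_point U"
proof (rule inj_onI)
  fix z w assume "z \<in> U" "w \<in> U" "line_point z = line_point w"
  then show "z = w"
    using eq_if_parallel[of z w "Re z" "Re w"] Re_nonzero_U by (auto simp: line_point_def)
qed

lemma hyperbola_point_notin_line: "A \<subseteq> U \<Longrightarrow> hyperbola_point ` A \<inter> line_point ` B = {}"
  using Re_nonzero_U by (auto simp: hyperbola_point_def line_point_def)

lemma card_hyperbola_line: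
  assumes "A \<subseteq> U" "B \<subseteq> U"
  shows "card (hyperbola_point ` A \<union> line_point ` B) = card A + card B"
proof -
  have "finite A" "finite B"
    using assms finite_U finite_subset by auto
  then show ?thesis
    using assms hyperbola_point_notin_line[OF assms(1)]
    by (simp add: card_Un_disjoint card_image inj_on_subset[OF inj_on_hyperbola_point]
        inj_on_subset[OF inj_on_line_point])
qed

lemma hyperbola_point_in_conic_iff:
  assumes z: "z \<in> U" and K: "K = {(x, y). a * x\<^sup>2 + b * x * y + c * y\<^sup>2 + d * x + e * y + f = 0}"
  shows "hyperbola_point z \<in> K \<longleftrightarrow> poly (hyperbola_conic_poly a b c d e f) z = 0"
proof -
  have "hyperbola_point z \<in> K \<longleftrightarrow>
      a + b * Im z + c * (Im z)\<^sup>2 + d * Re z + e * Im z * Re z + f * (Re z)\<^sup>2 = 0"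
    using Re_nonzero_U[OF z] unfolding K hyperbola_point_def
    by (simp add: field_simps power2_eq_square)
  then show ?thesis
    unfolding poly_hyperbola_conic_poly[OF norm_U[OF z]] using nonzero_U[OF z]
    by (simp only: mult_eq_0_iff of_real_eq_0_iff) simp
qed

lemma line_point_in_conic_iff:
  assumes v: "v \<in> U" and K: "K = {(x, y). a * x\<^sup>2 + b * x * y + c * y\<^sup>2 + d * x + e * y + f = 0}"
  shows "line_point v \<in> K \<longleftrightarrow> poly (line_conic_poly c e f) (v\<^sup>2) = 0"
proof -
  have "line_point v \<in> K \<longleftrightarrow> c * (Im v)\<^sup>2 + e * Im v * Re v + f * (Re v)\<^sup>2 = 0"
    using Re_nonzero_U[OF v] unfolding K line_point_def
    by (simp add: field_simps power2_eq_square)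
  then show ?thesis
    unfolding poly_line_conic_poly[OF norm_U[OF v]] using nonzero_U[OF v]
    by (simp only: mult_eq_0_iff of_real_eq_0_iff) simp
qed

text \<open>Having at least seven roots, both restrictions, of degrees at most 4 and 2, would vanish
  identically.\<close>

lemma hyperbola_line_not_subset_conic:
  assumes "is_conic K"
  shows "\<not> hyperbola_point ` U \<union> line_point ` U \<subseteq> K"
proof
  assume sub: "hyperbola_point ` U \<union> line_point ` U \<subseteq> K"
  obtain a b c d e f where nz: "a \<noteq> 0 \<or> b \<noteq> 0 \<or> c \<noteq> 0"
    and K: "K = {(x, y). a * x\<^sup>2 + b * x * y + c * y\<^sup>2 + d * x + e * y + f = 0}"
    using assms unfolding is_conic_def by blast
  have "hyperbola_conic_poly a b c d e f = 0"
  proof (rule ccontr)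
    assume "hyperbola_conic_poly a b c d e f \<noteq> 0"
    then have "card U \<le> degree (hyperbola_conic_poly a b c d e f)"
      using sub hyperbola_point_in_conic_iff[OF _ K] by (intro card_roots_le_degree) auto
    also have "\<dots> \<le> 4" by (simp add: hyperbola_conic_poly_def)
    finally show False using card_U large by simp
  qed
  moreover have "line_conic_poly c e f = 0"
  proof (rule ccontr)
    assume "line_conic_poly c e f \<noteq> 0"
    then have "card ((\<lambda>v. v\<^sup>2) ` U) \<le> degree (line_conic_poly c e f)"
      using sub line_point_in_conic_iff[OF _ K] by (intro card_roots_le_degree) auto
    also have "\<dots> \<le> 2" by (simp add: line_conic_poly_def)
    finally show False using card_U large by (simp add: card_image inj_on_square)
  qed
  ultimately show False
    using nz hyperbola_line_conic_poly_eq_0D by blast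
qed

text \<open>Only the line x = 0 reaches \<open>n\<close>, and it misses the hyperbola. Any other
  line has at most two points on the hyperbola and at most one on x = 0.\<close>

lemma card_hyperbola_line_line_le:
  assumes "is_line L"
  shows "card ((hyperbola_point ` U \<union> line_point ` U) \<inter> L) \<le> n"
proof -
  obtain \<alpha> \<beta> \<gamma> where nz: "\<alpha> \<noteq> 0 \<or> \<beta> \<noteq> 0" and L: "\<And>x y. (x, y) \<in> L \<longleftrightarrow> \<alpha> * x + \<beta> * y = \<gamma>"
    using is_line_equation[OF assms] by metis
  let ?P = "[:Complex (- \<gamma>) \<beta>, of_real (2 * \<alpha>), Complex (- \<gamma>) (- \<beta>):]"
  let ?A = "{z \<in> U. hyperbola_point z \<in> L}"
  let ?B = "{v \<in> U. line_point v \<in> L}"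
  have "(hyperbola_point ` U \<union> line_point ` U) \<inter> L = hyperbola_point ` ?A \<union> line_point ` ?B"
    by auto
  then have card: "card ((hyperbola_point ` U \<union> line_point ` U) \<inter> L) = card ?A + card ?B"
    by (simp add: card_hyperbola_line)
  show ?thesis
  \<comment> \<open>The first case is the line x = 0 itself.\<close>
  proof (cases "\<beta> = 0 \<and> \<gamma> = 0")
    case True
    with nz have "?A = {}"
      using Re_nonzero_U by (auto simp: L hyperbola_point_def)
    then have "card ?A = 0"
      by (simp only: card.empty)
    moreover have "card ?B \<le> card U"
      using finite_U by (intro card_mono) auto
    ultimately show ?thesis
      using card card_U by simp
  next
    case False
    have root: "poly ?P z = 0" if "z \<in> ?A" for z
    proof -
      have "z \<in> U" and *: "\<alpha> + \<beta> * Im z - \<gamma> * Re z = 0"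
        using that Re_nonzero_U by (auto simp: L hyperbola_point_def field_simps)
      then have z: "norm z = 1" "z \<noteq> 0"
        using norm_U nonzero_U by auto
      have i: "\<i> * (\<i> * x) = - x" for x by (simp flip: mult.assoc)
      have "poly ?P z = 2 * z * of_real (\<alpha> + \<beta> * Im z - \<gamma> * Re z)"
        unfolding of_real_add of_real_mult of_real_diff unit_circle_Re_Im[OF z(1)]
        using z(2) by (simp add: Complex_eq field_simps eval_nat_numeral i)
      with * show ?thesis by simp
    qed
    have "card ?A \<le> degree ?P"
      using nz root by (intro card_roots_le_degree) (auto simp: complex_eq_iff)
    also have "\<dots> \<le> 2" by simp
    finally have "card ?A \<le> 2" .
    moreover have "card ?B \<le> Suc 0"
    proof -
      have "v = w" if "v \<in> ?B" "w \<in> ?B" for v w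
      proof -
        have "\<beta> * (Im v / Re v) = \<gamma>" "\<beta> * (Im w / Re w) = \<gamma>"
          using that by (auto simp: L line_point_def)
        with False have "line_point v = line_point w"
          unfolding line_point_def by (metis mult_cancel_left mult_zero_left)
        with that show ?thesis
          using inj_on_line_point by (auto dest: inj_onD)
      qed
      then show ?thesis
        using finite_U by (simp add: card_le_Suc0_iff_eq)
    qed
    ultimately show ?thesis
      using card large by simp
  qed
qed

text \<open>The degrees 4 and 2 leave only the splittings 4 + 1 and 3 + 2. The polynomial whose
  roots are all known fixes the common product; the root missing from the other one is then a
  quotient in \<open>U\<close>, hence belongs to a point already counted. Contact is with the line
  in the first case and with the hyperbola in the second.\<close>

lemma hyperbola_line_conic_sixth_point:
  assumes "is_conic K"
  defines "A \<equiv> {z \<in> U. hyperbola_point z \<in> K}" and "B \<equiv> {v \<in> U. line_point v \<in> K}"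
  assumes card5: "card A + card B = 5"
  shows "(card A = 4 \<and> (\<exists>v. B = {v} \<and> (v\<^sup>2)\<^sup>2 = \<Prod>A)) \<or>
    (card A = 3 \<and> card B = 2 \<and> (\<exists>u\<in>A. u * \<Prod>A = (\<Prod>B)\<^sup>2))"
proof -
  have AB: "A \<subseteq> U" "B \<subseteq> U" "finite A" "finite B"
    using finite_U by (auto simp: A_def B_def)
  obtain a b c d e f
    where K: "K = {(x, y). a * x\<^sup>2 + b * x * y + c * y\<^sup>2 + d * x + e * y + f = 0}"
    using assms(1) unfolding is_conic_def by blast
  let ?P = "hyperbola_conic_poly a b c d e f" and ?Q = "line_conic_poly c e f"
  let ?W = "(\<lambda>v. v\<^sup>2) ` B"
  let ?t = "Complex (f - c) (- e)" and ?t' = "Complex (f - c) e"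
  have A_iff: "z \<in> A \<longleftrightarrow> poly ?P z = 0" if "z \<in> U" for z
    using hyperbola_point_in_conic_iff[OF that K] that by (auto simp: A_def)
  have B_iff: "v \<in> B \<longleftrightarrow> poly ?Q (v\<^sup>2) = 0" if "v \<in> U" for v
    using line_point_in_conic_iff[OF that K] that by (auto simp: B_def)
  have A_root: "\<And>z. z \<in> A \<Longrightarrow> poly ?P z = 0"
    using A_iff AB by auto
  have W: "finite ?W" "card ?W = card B" "\<And>w. w \<in> ?W \<Longrightarrow> poly ?Q w = 0" "\<Prod>?W = (\<Prod>B)\<^sup>2"
    using AB B_iff by (auto simp: card_image inj_on_subset[OF inj_on_square] prod.reindex prod_power_distrib)
  have P0: "?P \<noteq> 0"
  proof
    assume "?P = 0"
    then have "A = U" using A_iff AB by auto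
    then show False using card5 card_U large by simp
  qed
  have Q0: "?Q \<noteq> 0"
  proof
    assume "?Q = 0"
    then have "B = U" using B_iff AB by auto
    then show False using card5 card_U large by simp
  qed
  have "card A \<le> degree ?P"
    using P0 A_root by (rule card_roots_le_degree)
  also have "\<dots> \<le> 4" by (simp add: hyperbola_conic_poly_def)
  finally have A4: "card A \<le> 4" .
  have "card ?W \<le> degree ?Q"
    using Q0 W(3) by (rule card_roots_le_degree)
  also have "\<dots> \<le> 2" by (simp add: line_conic_poly_def)
  finally have B2: "card B \<le> 2" using W(2) by simp
  \<comment> \<open>If \<open>?t\<close> vanished, so would its conjugate \<open>?t'\<close>, and
    \<open>?Q\<close> would have no nonzero root. All five points would then lie on the hyperbola,
    which allows only four.\<close>
  have t: "?t \<noteq> 0"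
  proof
    assume "?t = 0"
    then have Q: "?Q = [:0, of_real (2 * c + 2 * f):]"
      by (auto simp: line_conic_poly_def complex_eq_iff)
    have "B = {}"
      using B_iff AB(2) nonzero_U Q0 unfolding Q by fastforce
    with card5 A4 show False by simp
  qed
  have P: "degree ?P = 4" "lead_coeff ?P = ?t" "coeff ?P 0 = ?t'"
    and Q: "degree ?Q = 2" "lead_coeff ?Q = ?t" "coeff ?Q 0 = ?t'"
    using t by (simp_all add: hyperbola_conic_poly_def line_conic_poly_def eval_nat_numeral)
  from card5 A4 B2 consider "card A = 4" "card B = 1" | "card A = 3" "card B = 2"
    by linarith
  then show ?thesis
  proof cases
    case 1
    then obtain v where v: "B = {v}"
      by (auto simp: card_1_singleton_iff)
    have "?t' = ?t * \<Prod>A"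
      using const_coeff_eq_prod_roots[OF AB(3) A_root P0, unfolded P(2,3)] P(1) 1 by simp
    moreover obtain r where r: "poly ?Q r = 0"
      "coeff ?Q 0 = (-1) ^ Suc (card ?W) * lead_coeff ?Q * (r * \<Prod>?W)"
      by (rule remaining_root[OF W(1,3)]) (use Q(1) W(2) 1 in simp_all)
    have "?t' = ?t * (r * v\<^sup>2)"
      using r(2) unfolding Q(2,3) W(2,4) 1 by (simp add: v)
    ultimately have eq: "r * v\<^sup>2 = \<Prod>A"
      using t by simp
    have vU: "v\<^sup>2 \<in> U"
      using AB v power_U by auto
    have "r = \<Prod>A / v\<^sup>2"
      using eq nonzero_U[OF vU] by (simp add: field_simps)
    then have rU: "r \<in> U"
      using divide_U prod_U AB vU by simp
    then have "half r \<in> B"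
      using B_iff[OF half_U[OF rU]] r(1) by (simp add: square_half)
    \<comment> \<open>As \<open>B\<close> is a singleton, the second root on the line can only
      repeat the first.\<close>
    then have "r = v\<^sup>2"
      using v square_half[OF rU] by simp
    with eq have "(v\<^sup>2)\<^sup>2 = \<Prod>A"
      by (simp add: power2_eq_square)
    with 1 v show ?thesis by blast
  next
    case 2
    have "?t' = ?t * (\<Prod>B)\<^sup>2"
      using const_coeff_eq_prod_roots[OF W(1,3) Q0, unfolded Q(2,3) W(2,4)] Q(1) 2 by simp
    moreover obtain r where r: "poly ?P r = 0"
      "coeff ?P 0 = (-1) ^ Suc (card A) * lead_coeff ?P * (r * \<Prod>A)"
      by (rule remaining_root[OF AB(3) A_root]) (use P(1) 2 in simp_all)
    have "?t' = ?t * (r * \<Prod>A)"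
      using r(2) unfolding P(2,3) 2 by simp
    ultimately have eq: "r * \<Prod>A = (\<Prod>B)\<^sup>2"
      using t by simp
    have AU: "\<Prod>A \<in> U"
      using AB by (intro prod_U)
    have "r = (\<Prod>B)\<^sup>2 / \<Prod>A"
      using eq nonzero_U[OF AU] by (simp add: field_simps)
    then have "r \<in> U"
      using divide_U prod_U power_U AB AU by simp
    then have "r \<in> A"
      using A_iff r(1) by simp
    with 2 eq show ?thesis by blast
  qed
qed

lemma card_ordinary_conics_hyperbola_line:
  "card (ordinary_conics (hyperbola_point ` U \<union> line_point ` U)) \<le> (n choose 4) + (n choose 2)\<^sup>2"
proof -
  let ?S = "hyperbola_point ` U \<union> line_point ` U"
  define trace where
    "trace K = ({z \<in> U. hyperbola_point z \<in> K}, {v \<in> U. line_point v \<in> K})" for K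
  have trace: "K \<inter> ?S = hyperbola_point ` fst (trace K) \<union> line_point ` snd (trace K)" for K
    by (auto simp: trace_def)
  have inj: "inj_on trace (ordinary_conics ?S)"
    by (rule inj_onI, erule (1) ordinary_conic_eqI) (simp add: trace)
  let ?R = "\<lambda>k. {R. R \<subseteq> U \<and> card R = k}"
  \<comment> \<open>\<open>?g\<close> recovers the point of contact on the line as a fourth root of
    the product over the hyperbola. \<open>?h\<close> recovers the point of contact on the hyperbola
    as a square root, from two points on each component.\<close>
  let ?g = "\<lambda>R. (R, {half (half (\<Prod>R))})"
  let ?h = "\<lambda>(R, B). (insert (half ((\<Prod>B)\<^sup>2 / \<Prod>R)) R, B)"
  have fin: "finite (?R k)" for k
    using finite_U by simp
  have "trace ` ordinary_conics ?S \<subseteq> ?g ` ?R 4 \<union> ?h ` (?R 2 \<times> ?R 2)"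
  proof (rule image_subsetI)
    fix K assume K: "K \<in> ordinary_conics ?S"
    define A B where "A = {z \<in> U. hyperbola_point z \<in> K}" and "B = {v \<in> U. line_point v \<in> K}"
    have tr: "trace K = (A, B)" and AB: "A \<subseteq> U" "B \<subseteq> U"
      by (auto simp: trace_def A_def B_def)
    have "is_conic K" "card A + card B = 5"
      using K trace[of K] card_hyperbola_line[OF AB] tr
      by (auto simp: ordinary_conics_def ordinary_conic_def)
    then consider v where "card A = 4" "B = {v}" "(v\<^sup>2)\<^sup>2 = \<Prod>A"
      | u where "card A = 3" "card B = 2" "u \<in> A" "u * \<Prod>A = (\<Prod>B)\<^sup>2"
      using hyperbola_line_conic_sixth_point[of K] unfolding A_def B_def by blast
    then show "trace K \<in> ?g ` ?R 4 \<union> ?h ` (?R 2 \<times> ?R 2)"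
    proof cases
      case 1
      then have "half (half (\<Prod>A)) = v"
        using half_square AB power_U by (metis insert_subset)
      with 1 AB tr show ?thesis by auto
    next
      case 2
      let ?T = "A - {u}"
      have finA: "finite A" using AB(1) finite_U by (rule finite_subset)
      have "u * (u * \<Prod>?T) = (\<Prod>B)\<^sup>2"
        using 2 prod.remove[OF finA 2(3), of "\<lambda>x. x"] by simp
      moreover have "\<Prod>?T \<noteq> 0"
        using AB by (intro nonzero_U prod_U) auto
      ultimately have "(\<Prod>B)\<^sup>2 / \<Prod>?T = u\<^sup>2"
        by (auto simp: field_simps power2_eq_square)
      then have "(A, B) = ?h (?T, B)"
        using 2 half_square AB by auto
      moreover have "(?T, B) \<in> ?R 2 \<times> ?R 2"
        using AB 2 finA by auto
      ultimately have "trace K \<in> ?h ` (?R 2 \<times> ?R 2)"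
        unfolding tr by (rule image_eqI)
      then show ?thesis by blast
    qed
  qed
  then have "card (trace ` ordinary_conics ?S) \<le> card (?g ` ?R 4 \<union> ?h ` (?R 2 \<times> ?R 2))"
    using fin by (intro card_mono) auto
  also have "\<dots> \<le> card (?g ` ?R 4) + card (?h ` (?R 2 \<times> ?R 2))"
    by (rule card_Un_le)
  also have "\<dots> \<le> card (?R 4) + card (?R 2 \<times> ?R 2)"
    using fin by (intro add_mono card_image_le) auto
  finally show ?thesis
    using inj by (simp add: card_image n_subsets finite_U card_U card_cartesian_product power2_eq_square)
qed

end

section \<open>Binomial estimates and the final counts\<close>

lemma choose_4_le: "real (n choose 4) \<le> real n ^ 4 / 24"
proof -
  have "real ((n choose 4) * fact 4) \<le> real (n ^ 4)"
    using binomial_fact_pow[of n 4] by (rule of_nat_mono)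
  then show ?thesis by (simp add: fact_numeral)
qed

lemma choose_2_square_le: "real ((n choose 2)\<^sup>2) \<le> real n ^ 4 / 4"
proof -
  have "real ((n choose 2) * fact 2) \<le> real (n ^ 2)"
    using binomial_fact_pow[of n 2] by (rule of_nat_mono)
  then have "real (n choose 2) \<le> real n ^ 2 / 2"
    by simp
  then have "(real (n choose 2))\<^sup>2 \<le> (real n ^ 2 / 2)\<^sup>2"
    by (rule power_mono) simp
  then show ?thesis
    by (simp add: power_divide flip: power_mult)
qed

theorem theorem1p2:
  shows "(\<forall>N :: nat. \<exists>S :: (real \<times> real) set.
            finite S \<and> card S \<ge> N \<and>
            \<not> (\<exists>K. is_conic K \<and> S \<subseteq> K) \<and>
            \<not> (\<exists>L. is_line L \<and> card (S \<inter> L) \<ge> 4) \<and>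
            real (card (ordinary_conics S)) \<le> 1 / 24 * real (card S) ^ 4)
       \<and> (\<exists>C :: real. \<forall>N :: nat. \<exists>S :: (real \<times> real) set.
            finite S \<and> card S \<ge> N \<and>
            \<not> (\<exists>K. is_conic K \<and> S \<subseteq> K) \<and>
            (\<forall>L. is_line L \<longrightarrow> real (card (S \<inter> L)) \<le> real (card S) / 2) \<and>
            real (card (ordinary_conics S)) \<le> 7 / 384 * real (card S) ^ 4 + C * real (card S) ^ 3)"
proof (intro conjI exI[of _ "0::real"] allI)
  fix N :: nat
  \<comment> \<open>The order 2N + 7 is odd, at least 7 and at least \<open>N\<close>.\<close>
  interpret odd_roots_of_unity "2 * N + 7" "{z. z ^ (2 * N + 7) = 1}"
    by unfold_locales auto
  let ?n = "2 * N + 7"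
  let ?U = "{z::complex. z ^ ?n = 1}"
  let ?S = "cubic_point ` ?U"
  have card_S: "card ?S = ?n"
    using card_image[OF inj_on_cubic_point] card_U by simp
  have "real (card (ordinary_conics ?S)) \<le> real (?n choose 4)"
    using card_ordinary_conics_cubic by (rule of_nat_mono)
  also have "\<dots> \<le> 1 / 24 * real (card ?S) ^ 4"
    using choose_4_le[of ?n] unfolding card_S by simp
  finally show "\<exists>S :: (real \<times> real) set. finite S \<and> card S \<ge> N \<and>
            \<not> (\<exists>K. is_conic K \<and> S \<subseteq> K) \<and>
            \<not> (\<exists>L. is_line L \<and> card (S \<inter> L) \<ge> 4) \<and>
            real (card (ordinary_conics S)) \<le> 1 / 24 * real (card S) ^ 4"
    using finite_U card_S cubic_not_subset_conic card_cubic_line_le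
    by (intro exI[of _ ?S] conjI) force+
next
  fix N :: nat
  interpret odd_roots_of_unity "2 * N + 7" "{z. z ^ (2 * N + 7) = 1}"
    by unfold_locales auto
  let ?n = "2 * N + 7"
  let ?U = "{z::complex. z ^ ?n = 1}"
  let ?S = "hyperbola_point ` ?U \<union> line_point ` ?U"
  have card_S: "card ?S = 2 * ?n"
    using card_hyperbola_line[OF order_refl order_refl] card_U by simp
  have "real (card (ordinary_conics ?S)) \<le> real ((?n choose 4) + (?n choose 2)\<^sup>2)"
    using card_ordinary_conics_hyperbola_line by (rule of_nat_mono)
  also have "\<dots> \<le> real ?n ^ 4 / 24 + real ?n ^ 4 / 4"
    using choose_4_le[of ?n] choose_2_square_le[of ?n] by simp
  \<comment> \<open>1/24 + 1/4 = 7/24, and n^4 is 1/16 of the fourth power of the size 2n. Both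
    binomial bounds are pure fourth powers, so C = 0 suffices.\<close>
  also have "\<dots> = 7 / 384 * real (card ?S) ^ 4 + 0 * real (card ?S) ^ 3"
    unfolding card_S of_nat_mult power_mult_distrib by simp
  finally have bound: "real (card (ordinary_conics ?S)) \<le> 7 / 384 * real (card ?S) ^ 4 + 0 * real (card ?S) ^ 3" .
  have line: "real (card (?S \<inter> L)) \<le> real (card ?S) / 2" if "is_line L" for L
    using of_nat_mono[where 'a = real, OF card_hyperbola_line_line_le[OF that]] unfolding card_S by simp
  show "\<exists>S :: (real \<times> real) set. finite S \<and> card S \<ge> N \<and>
            \<not> (\<exists>K. is_conic K \<and> S \<subseteq> K) \<and>
            (\<forall>L. is_line L \<longrightarrow> real (card (S \<inter> L)) \<le> real (card S) / 2) \<and>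
            real (card (ordinary_conics S)) \<le> 7 / 384 * real (card S) ^ 4 + 0 * real (card S) ^ 3"
  proof (intro exI[of _ ?S] conjI allI impI notI)
    show "finite ?S"
      using finite_U by simp
    show "N \<le> card ?S"
      unfolding card_S by simp
  qed (use bound line hyperbola_line_not_subset_conic in blast)+
qed

end
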